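(* Let $a,b,c$ be real numbers, not all zero, and let $\{\mathcal{J}g_{n}^{(3)}\}_{n\geq 0}$ be the generalized Gaussian third-order Jacobsthal sequence with parameters $a,b,c$. Put $\lambda=a+b+c$, $\lambda_{1}=4a+4b-3c+(2a-5b+2c)i$, $\lambda_{2}=6a-b-c-(4a+4b-3c)i$ and $\Psi_{k}=(2\lambda_{1}+\lambda_{2})\Omega_{k}+(3\lambda_{2}-\lambda_{1})\Omega_{k+1}$ for integers $k\ge 0$. Then for every integer $n\geq 1$, $$ \left[\mathcal{J}g_{n}^{(3)}\right]^{2}-\mathcal{J}g_{n-1}^{(3)}\mathcal{J}g_{n+1}^{(3)}=\frac{1}{49}\Big\{\lambda_{1}^{2}-\lambda_{1}\lambda_{2}+\lambda_{2}^{2}+\lambda\left(1+\tfrac{i}{2}\right)2^{n-1}\left[\Psi_{n}-2\Psi_{n-1}\right]\Big\}. $$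
   Context: Here $i$ is the imaginary unit. The generalized Gaussian third-order Jacobsthal sequence with real parameters $a,b,c$ (not all zero) is the sequence of complex numbers defined by $\mathcal{J}g_{n+3}^{(3)}=\mathcal{J}g_{n+2}^{(3)}+\mathcal{J}g_{n+1}^{(3)}+2\mathcal{J}g_{n}^{(3)}$ for $n\ge 0$, with $\mathcal{J}g_{0}^{(3)}=a+\frac{1}{2}(c-b-a)i$, $\mathcal{J}g_{1}^{(3)}=b+ai$, $\mathcal{J}g_{2}^{(3)}=c+bi$. For an integer $n$, $\Omega_{n}=\frac{\omega_1^n-\omega_2^n}{\omega_1-\omega_2}$, where $\omega_1,\omega_2$ are the roots of $x^2+x+1=0$; equivalently $\Omega_n=0,1,-1$ according as $n\equiv 0,1,2 \pmod 3$. *)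

theory Defs
  imports Complex_Main
begin

fun gaussian_jacobsthal3 :: "real \<Rightarrow> real \<Rightarrow> real \<Rightarrow> nat \<Rightarrow> complex" where
  "gaussian_jacobsthal3 a b c 0 = of_real a + (1/2) * of_real (c - b - a) * \<i>"
| "gaussian_jacobsthal3 a b c (Suc 0) = of_real b + of_real a * \<i>"
| "gaussian_jacobsthal3 a b c (Suc (Suc 0)) = of_real c + of_real b * \<i>"
| "gaussian_jacobsthal3 a b c (Suc (Suc (Suc n))) =
     gaussian_jacobsthal3 a b c (Suc (Suc n)) + gaussian_jacobsthal3 a b c (Suc n)
       + 2 * gaussian_jacobsthal3 a b c n"

definition omega1 :: complex where
  "omega1 = Complex (-1/2) (sqrt 3 / 2)"

definition omega2 :: complex where
  "omega2 = Complex (-1/2) (- sqrt 3 / 2)"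

lemma omega_roots: "{x::complex. x\<^sup>2 + x + 1 = 0} = {omega1, omega2}"
proof -
  have "x\<^sup>2 + x + 1 = (x - omega1) * (x - omega2)" for x :: complex
    by (simp add: complex_eq_iff omega1_def omega2_def power2_eq_square algebra_simps)
  then show ?thesis by auto
qed

(* Symmetric in the two roots, so the labelling of omega1 and omega2 does not matter. *)
definition Omega :: "int \<Rightarrow> complex" where
  "Omega n = (omega1 powi n - omega2 powi n) / (omega1 - omega2)"

definition lam :: "real \<Rightarrow> real \<Rightarrow> real \<Rightarrow> real" where
  "lam a b c = a + b + c"

definition lam1 :: "real \<Rightarrow> real \<Rightarrow> real \<Rightarrow> complex" where
  "lam1 a b c = of_real (4*a + 4*b - 3*c) + of_real (2*a - 5*b + 2*c) * \<i>"

definition lam2 :: "real \<Rightarrow> real \<Rightarrow> real \<Rightarrow> complex" where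
  "lam2 a b c = of_real (6*a - b - c) - of_real (4*a + 4*b - 3*c) * \<i>"

definition Psi :: "real \<Rightarrow> real \<Rightarrow> real \<Rightarrow> nat \<Rightarrow> complex" where
  "Psi a b c k = (2 * lam1 a b c + lam2 a b c) * Omega (int k)
     + (3 * lam2 a b c - lam1 a b c) * Omega (int k + 1)"

end

(* Split off the dominant root 2 of the characteristic polynomial (x - 2)(x^2 + x + 1):
   7 J_n = lam (1 + i/2) 2^n + V_n, where V_n = lam1 Omega_n + lam2 Omega_(n+1) satisfies
   V_(n+2) = - V_(n+1) - V_n.  In J_n^2 - J_(n-1) J_(n+1) the 4^n terms cancel, the terms in 2^n
   give the Psi part, and V_n^2 - V_(n-1) V_(n+1) is constant because
   Omega_n^2 + Omega_n Omega_(n+1) + Omega_(n+1)^2 is. *)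

theory Submission
  imports Defs
begin

lemma Omega_0 [simp]: "Omega 0 = 0"
  by (simp add: Omega_def)

lemma omega1_neq_omega2: "omega1 \<noteq> omega2"
  by (simp add: omega1_def omega2_def)

lemma Omega_1 [simp]: "Omega 1 = 1"
  using omega1_neq_omega2 by (simp add: Omega_def)

text \<open>Multiplying \<open>x\<^sup>2 + x + 1 = 0\<close> by \<open>x powi k\<close> gives the
  recurrence for the powers of each root, and it passes to their linear combination
  \<open>Omega\<close>.\<close>

lemma Omega_rec: "Omega (k + 2) = - Omega (k + 1) - Omega k"
proof -
  have root_rec: "x powi (k + 2) = - (x powi (k + 1)) - x powi k"
    if "x \<in> {omega1, omega2}" for x :: complex
  proof -
    have x: "x\<^sup>2 + x + 1 = 0"
      using that omega_roots by blast
    \<comment> \<open>The exponent \<open>k\<close> may be negative, so splitting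
      \<open>x powi (k + 2)\<close> requires a nonzero base.\<close>
    then have nz: "x \<noteq> 0"
      by auto
    have "x powi (k + 2) + x powi (k + 1) + x powi k = x powi k * (x\<^sup>2 + x + 1)"
      using nz by (simp add: power_int_add algebra_simps)
    with x show ?thesis
      by (simp add: algebra_simps eq_neg_iff_add_eq_0)
  qed
  show ?thesis
    by (simp add: Omega_def root_rec diff_divide_distrib add_divide_distrib)
qed

text \<open>The quadratic form is invariant under the shift (x, y) -> (y, -y - x), so it keeps its
  value at (0, 1).\<close>

lemma Omega_norm:
  "(Omega (int n))\<^sup>2 + Omega (int n) * Omega (int n + 1) + (Omega (int n + 1))\<^sup>2 = 1"
proof (induction n)
  case 0
  show ?case by simp
next
  case (Suc n)
  have Om: "Omega (int (Suc n)) = Omega (int n + 1)"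
    "Omega (int (Suc n) + 1) = - Omega (int n + 1) - Omega (int n)"
    using Omega_rec[of "int n"] by (simp_all add: add.commute)
  have "y\<^sup>2 + y * (- y - x) + (- y - x)\<^sup>2 = x\<^sup>2 + x * y + y\<^sup>2" for x y :: complex
    by (simp add: power2_eq_square algebra_simps)
  then show ?case
    unfolding Om using Suc by (rule trans)
qed

text \<open>Both sides satisfy the same third-order recurrence, so agreement at 0, 1 and 2
  suffices.\<close>

lemma gaussian_jacobsthal3_binet:
  "7 * gaussian_jacobsthal3 a b c n
    = of_real (lam a b c) * (1 + \<i> / 2) * 2 ^ n
      + lam1 a b c * Omega (int n) + lam2 a b c * Omega (int n + 1)"
proof (induction a b c n rule: gaussian_jacobsthal3.induct)
  case (1 a b c)
  show ?case
    by (simp add: lam_def lam1_def lam2_def complex_eq_iff field_simps)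
next
  case (2 a b c)
  show ?case
    using Omega_rec[of 0]
    by (simp add: lam_def lam1_def lam2_def complex_eq_iff field_simps)
next
  case (3 a b c)
  show ?case
    using Omega_rec[of 0] Omega_rec[of 1]
    by (simp add: lam_def lam1_def lam2_def complex_eq_iff field_simps)
next
  case (4 a b c n)
  let ?J = "gaussian_jacobsthal3 a b c" and ?x = "Omega (int n)" and ?y = "Omega (int n + 1)"
  \<comment> \<open>Iterating the recurrence shows that \<open>Omega\<close> has period 3, so every
    value needed reduces to \<open>?x\<close> and \<open>?y\<close>.\<close>
  have Om: "Omega (int n + 2) = - ?y - ?x" "Omega (int n + 3) = ?x" "Omega (int n + 4) = ?y"
    using Omega_rec[of "int n"] Omega_rec[of "int n + 1"] Omega_rec[of "int n + 2"]
    by (simp_all add: add.assoc)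
  have "7 * ?J (Suc (Suc (Suc n)))
      = 7 * ?J (Suc (Suc n)) + 7 * ?J (Suc n) + 2 * (7 * ?J n)"
    by simp
  also note "4.IH"(1)
  also note "4.IH"(2)
  also note "4.IH"(3)
  finally show ?case
    using Om by (simp add: algebra_simps)
qed

theorem theorem2p8:
  fixes a b c :: real and n :: nat
  assumes "\<not> (a = 0 \<and> b = 0 \<and> c = 0)"
    and "n \<ge> 1"
  shows "(gaussian_jacobsthal3 a b c n)\<^sup>2
      - gaussian_jacobsthal3 a b c (n - 1) * gaussian_jacobsthal3 a b c (n + 1)
    = (1/49) * ((lam1 a b c)\<^sup>2 - lam1 a b c * lam2 a b c + (lam2 a b c)\<^sup>2
        + of_real (lam a b c) * (1 + \<i> / 2) * 2 ^ (n - 1)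
            * (Psi a b c n - 2 * Psi a b c (n - 1)))"
proof -
  obtain m where n: "n = Suc m"
    using assms(2) by (cases n) auto
  let ?J = "gaussian_jacobsthal3 a b c"
  define A where "A = lam1 a b c"
  define B where "B = lam2 a b c"
  \<comment> \<open>The dominant part of \<open>7 * ?J m\<close>; it doubles at each index step,
    giving \<open>2 * t\<close> and \<open>4 * t\<close> below.\<close>
  define t where "t = of_real (lam a b c) * (1 + \<i> / 2) * (2::complex) ^ m"
  define x where "x = Omega (int m)"
  define y where "y = Omega (int m + 1)"
  have Om: "Omega (int m + 2) = - y - x" "Omega (int m + 3) = x"
    using Omega_rec[of "int m"] Omega_rec[of "int m + 1"]
    by (simp_all add: x_def y_def add.assoc)
  have norm: "x\<^sup>2 + x * y + y\<^sup>2 = 1"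
    unfolding x_def y_def by (rule Omega_norm)
  have J0: "7 * ?J m = t + A * x + B * y"
    by (simp add: gaussian_jacobsthal3_binet A_def B_def t_def x_def y_def)
  have J1: "7 * ?J (Suc m) = 2 * t + A * y + B * (- y - x)"
    unfolding gaussian_jacobsthal3_binet
    using Om by (simp add: A_def B_def t_def x_def y_def add.commute add.left_commute)
  have J2: "7 * ?J (Suc (Suc m)) = 4 * t + A * (- y - x) + B * x"
    unfolding gaussian_jacobsthal3_binet
    using Om by (simp add: A_def B_def t_def x_def y_def add.commute add.left_commute)
  have Psi0: "Psi a b c m = (2 * A + B) * x + (3 * B - A) * y"
    by (simp add: Psi_def A_def B_def x_def y_def)
  have Psi1: "Psi a b c (Suc m) = (2 * A + B) * y + (3 * B - A) * (- y - x)"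
    using Om by (simp add: Psi_def A_def B_def x_def y_def add.commute add.left_commute)
  have "49 * ((?J (Suc m))\<^sup>2 - ?J m * ?J (Suc (Suc m)))
      = (7 * ?J (Suc m))\<^sup>2 - (7 * ?J m) * (7 * ?J (Suc (Suc m)))"
    by (simp add: power2_eq_square algebra_simps)
  \<comment> \<open>Write V_k for the non-dominant part of 7 J_k. The squares of \<open>t\<close>
    cancel, and \<open>t\<close> has coefficient 4 V_(m+1) - V_(m+2) - 4 V_m. This is the difference
    of \<open>Psi\<close> values shown, because Psi_k = 2 V_k - V_(k+1). The rest is V_(m+1)^2 - V_m
    V_(m+2), which factors as the first product.\<close>
  also have "\<dots> = (A\<^sup>2 - A * B + B\<^sup>2) * (x\<^sup>2 + x * y + y\<^sup>2)
      + t * (Psi a b c (Suc m) - 2 * Psi a b c m)"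
    unfolding J0 J1 J2 Psi0 Psi1 by (simp add: power2_eq_square algebra_simps)
  finally have "49 * ((?J (Suc m))\<^sup>2 - ?J m * ?J (Suc (Suc m)))
      = A\<^sup>2 - A * B + B\<^sup>2 + t * (Psi a b c (Suc m) - 2 * Psi a b c m)"
    by (simp add: norm)
  then have "(?J (Suc m))\<^sup>2 - ?J m * ?J (Suc (Suc m))
      = (1/49) * (A\<^sup>2 - A * B + B\<^sup>2 + t * (Psi a b c (Suc m) - 2 * Psi a b c m))"
    by (simp add: field_simps)
  then show ?thesis
    by (simp add: n A_def B_def t_def)
qed

end
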